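(* Let $Z_*$ be the limit in distribution of $\hat Z_N$ as $N\to\infty$, and let $\Lambda$ be its distribution function. (a) The random variable $Z_*$ and its distribution $\Lambda$ are uniquely determined by both the moments and the cumulants. (b) Moreover, $Z_*$ admits the stochastic representation \[ Z_* \overset{d}{=} \sum_{i=1}^{\infty}\frac{U_i}{2^i}, \] where $U_1,U_2,\ldots$ are independent random variables, each (absolutely continuous and) uniformly distributed on $[-3,3]$. As a consequence, $Z_*$ is bounded and its support is $[-3,3]$.
   Context: For each integer $N\ge 1$, let $\Omega_N$ be the set of all $\omega=(k_1,\ldots,k_N)$ of integers with $0\le k_j\le 2^j-1$, $j=1,\ldots,N$, equipped with the uniform probability ${\bf P}(\omega)=2^{-N(N+1)/2}$, and let $Z_N(\omega)=k_1+\cdots+k_N$. Let $\mu_N={\bf E}Z_N$, $\sigma_N^2={\bf Var}\,Z_N$ (with $\sigma_N>0$), and $\hat Z_N=(Z_N-\mu_N)/\sigma_N$. The sequence $\hat Z_N$ converges in distribution as $N\to\infty$ to a random variable denoted $Z_*$. The cumulants $\kappa_j(\xi)$ of a random variable $\xi$ with all moments finite are the coefficients in the (formal) expansion $\log {\bf E}e^{t\xi}=\sum_{j\ge1}\kappa_j(\xi)\,t^j/j!$. "Uniquely determined by the moments (cumulants)" means that any random variable with all moments finite and having the same moment (cumulant) sequence has the same distribution. The symbol $\overset{d}{=}$ denotes equality in distribution. *)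

theory Defs
  imports
    "HOL-Probability.Probability"
    "HOL-Computational_Algebra.Formal_Power_Series"
begin

(* Tuples (k_1, ..., k_N) are functions on {1..N}, set to undefined elsewhere. *)
definition Omega :: "nat \<Rightarrow> (nat \<Rightarrow> int) set" where
  "Omega N = (\<Pi>\<^sub>E j\<in>{1..N}. {0..2 ^ j - 1})"

definition P_N :: "nat \<Rightarrow> (nat \<Rightarrow> int) measure" where
  "P_N N = uniform_count_measure (Omega N)"

definition Z_N :: "nat \<Rightarrow> (nat \<Rightarrow> int) \<Rightarrow> real" where
  "Z_N N \<omega> = real_of_int (\<Sum>j=1..N. \<omega> j)"

definition mu_N :: "nat \<Rightarrow> real" where
  "mu_N N = (\<integral>\<omega>. Z_N N \<omega> \<partial>P_N N)"

definition sigma_N :: "nat \<Rightarrow> real" where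
  "sigma_N N = sqrt (\<integral>\<omega>. (Z_N N \<omega> - mu_N N)\<^sup>2 \<partial>P_N N)"

(* For N = 0, which the mathematics excludes, sigma_N 0 = 0 and this is the constant 0;
   only the behaviour as N tends to infinity is ever used. *)
definition Zhat_N :: "nat \<Rightarrow> (nat \<Rightarrow> int) \<Rightarrow> real" where
  "Zhat_N N \<omega> = (Z_N N \<omega> - mu_N N) / sigma_N N"

lemma card_Omega: "card (Omega N) = 2 ^ (N * (N + 1) div 2)"
proof -
  have "card {0..(2::int) ^ j - 1} = 2 ^ j" for j :: nat
    by (simp add: nat_power_eq)
  then have "card (Omega N) = (\<Prod>j=1..N. 2 ^ j)"
    unfolding Omega_def by (subst card_PiE) (simp_all only: finite_atLeastAtMost)
  also have "\<dots> = 2 ^ (\<Sum>j=1..N. j)"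
    by (simp add: power_sum)
  also have "(\<Sum>j=1..N. j) = N * (N + 1) div 2"
    using gauss_sum_from_Suc_0[of N, where ?'a = nat] by simp
  finally show ?thesis .
qed

definition all_moments_finite :: "'a measure \<Rightarrow> ('a \<Rightarrow> real) \<Rightarrow> bool" where
  "all_moments_finite M X \<longleftrightarrow>
     X \<in> borel_measurable M \<and> (\<forall>k. integrable M (\<lambda>\<omega>. X \<omega> ^ k))"

definition moment :: "'a measure \<Rightarrow> ('a \<Rightarrow> real) \<Rightarrow> nat \<Rightarrow> real" where
  "moment M X k = (\<integral>\<omega>. X \<omega> ^ k \<partial>M)"

(* The formal power series E exp(t X) = sum over k of E(X^k) t^k / k!. *)
definition mgf_fps :: "'a measure \<Rightarrow> ('a \<Rightarrow> real) \<Rightarrow> real fps" where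
  "mgf_fps M X = Abs_fps (\<lambda>k. moment M X k / fact k)"

(* fps_ln 1 is the formal series of log(1 + t), so the composition is log E exp(t X). *)
definition cumulant :: "'a measure \<Rightarrow> ('a \<Rightarrow> real) \<Rightarrow> nat \<Rightarrow> real" where
  "cumulant M X j = fact j * fps_nth (fps_compose (fps_ln 1) (mgf_fps M X - 1)) j"

definition dist_support :: "real measure \<Rightarrow> real set" where
  "dist_support D = {x. \<forall>S. open S \<and> x \<in> S \<longrightarrow> emeasure D S > 0}"

(* U 1, U 2, ... are independent and uniform on [-3, 3]; the value U 0 is not used. *)
definition iid_uniform_3 :: "'a measure \<Rightarrow> (nat \<Rightarrow> 'a \<Rightarrow> real) \<Rightarrow> bool" where
  "iid_uniform_3 P U \<longleftrightarrow>
     prob_space.indep_vars P (\<lambda>_. borel) U {1..} \<and>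
     (\<forall>i\<ge>1. distributed P lborel (U i)
        (\<lambda>x. ennreal (indicator {-3..3} x / measure lborel {-3..3::real})))"

end

theory Submission
  imports Defs "HOL-Real_Asymp.Real_Asymp"
begin

text \<open>
  The number \<open>k\<^sub>j\<close> is uniform on \<open>2\<^sup>j\<close> consecutive integers, so, centred and divided by \<open>2\<^sup>N\<close>, it is
  a lattice approximation, with mesh \<open>2\<^sup>-\<^sup>N\<close>, of a continuous uniform variable on an interval of
  length \<open>2\<^sup>j\<^sup>-\<^sup>N\<close>. Since \<open>\<sigma>\<^sub>N\<close> is asymptotically \<open>2\<^sup>N / 3\<close>, the normalised coordinate is close to
  \<open>U\<^sub>i / 2\<^sup>i\<close> with \<open>i = N + 1 - j\<close> and \<open>U\<^sub>i\<close> uniform on \<open>[-3, 3]\<close>: reading the coordinates from the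
  last one to the first turns the sum into a partial sum of the series.

  Characteristic functions make this precise. The one of the normalised sum is a product over the
  coordinates. Each factor is a midpoint Riemann sum of the integral that defines the
  characteristic function of the uniform law, and the two differ by at most \<open>\<bar>t\<bar> / \<sigma>\<^sub>N\<close>
  (\<open>char_centred_near_char_unif3\<close>). All factors lie in the unit disc, so the products differ by at
  most \<open>N \<bar>t\<bar> / \<sigma>\<^sub>N\<close>, which tends to \<open>0\<close>. What remains is the characteristic function of the
  \<open>N\<close>-th partial sum at \<open>t 2\<^sup>N / (3 \<sigma>\<^sub>N)\<close>, and it converges to that of the series by dominated
  convergence. As weak convergence implies convergence of characteristic functions, Levy's
  uniqueness theorem identifies the law of \<open>Z\<close> (\<open>distr_weak_limit_eq_distr_series\<close>).

  The series is bounded by \<open>3\<close>. Hence the even moments are at most \<open>3\<^sup>2\<^sup>k\<close>, and the Taylor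
  polynomials of the characteristic function, whose coefficients are moments, converge to it
  everywhere; any variable with the same moments therefore has the same characteristic function
  (\<open>distr_eq_if_moments_eq\<close>). Cumulants determine moments because composition with the formal
  logarithm has the formal exponential as an inverse. Finally, a point \<open>x\<close> of \<open>[-3, 3]\<close> lies in the
  support because \<open>x = \<Sum>\<^sub>i x / 2\<^sup>i\<close>: it suffices that finitely many of the \<open>U\<^sub>i\<close> lie close to the
  same point \<open>x\<close>, an event of positive probability (\<open>dist_support_series\<close>).
\<close>

section \<open>Cumulants determine moments, and bounded moments determine the law\<close>

text \<open>The series of \<open>exp - 1\<close> is a left inverse of the series of \<open>log (1 + t)\<close> under composition.\<close>

lemma fps_ln_compose_inject:
  fixes a b :: "real fps"
  assumes "fps_nth a 0 = 0" "fps_nth b 0 = 0" "fps_ln 1 oo a = fps_ln 1 oo b"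
  shows "a = b"
proof -
  have inv: "(fps_exp 1 - 1) oo fps_ln (1::real) = fps_X"
    by (subst fps_ln_fps_exp_inv) (auto intro!: fps_inv_right)
  have "c = (fps_exp 1 - 1) oo (fps_ln 1 oo c)" if "fps_nth c 0 = 0" for c :: "real fps"
    using that by (simp add: fps_compose_assoc inv)
  with assms show ?thesis by metis
qed

lemma (in prob_space) moment_0: "moment M X 0 = 1"
  by (simp add: moment_def prob_space)

lemma moments_eq_if_cumulants_eq:
  assumes "prob_space P" "prob_space M" "\<forall>j\<ge>1. cumulant P Y j = cumulant M Z j"
  shows "moment P Y k = moment M Z k"
proof -
  have "mgf_fps P Y - 1 = mgf_fps M Z - 1"
  proof (rule fps_ln_compose_inject)
    show "fps_nth (mgf_fps P Y - 1) 0 = 0" "fps_nth (mgf_fps M Z - 1) 0 = 0"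
      using assms(1,2) by (simp_all add: mgf_fps_def prob_space.moment_0)
    show "fps_ln 1 oo (mgf_fps P Y - 1) = fps_ln 1 oo (mgf_fps M Z - 1)"
    proof (rule fps_ext)
      fix j show "fps_nth (fps_ln 1 oo (mgf_fps P Y - 1)) j = fps_nth (fps_ln 1 oo (mgf_fps M Z - 1)) j"
        using assms(3) by (cases "j = 0") (auto simp: cumulant_def)
    qed
  qed
  then have "fps_nth (mgf_fps P Y) k = fps_nth (mgf_fps M Z) k" by simp
  then show ?thesis by (simp add: mgf_fps_def)
qed

lemma char_moment_approx:
  assumes "prob_space M" "all_moments_finite M X" "even n"
  shows "cmod (char (distr M borel X) t - (\<Sum>k\<le>n. ((\<i> * t) ^ k / fact k) * moment M X k))
           \<le> 2 * (\<bar>t\<bar> ^ n / fact n) * moment M X n"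
proof -
  interpret prob_space M by fact
  have [measurable]: "X \<in> borel_measurable M" and int: "\<And>k. integrable M (\<lambda>\<omega>. X \<omega> ^ k)"
    using assms(2) by (auto simp: all_moments_finite_def)
  interpret D: real_distribution "distr M borel X" by simp
  show ?thesis
    using D.char_approx1[of n t] int assms(3)
    by (simp add: integrable_distr_eq integral_distr moment_def power_even_abs)
qed

text \<open>
  The two characteristic functions have the same Taylor polynomials. The remainder of even order
  involves no absolute moment, so the common moments alone control it for both variables.
\<close>

lemma distr_eq_if_moments_eq:
  assumes P: "prob_space P" "all_moments_finite P Y"
    and M: "prob_space M" "all_moments_finite M Z"
    and eq: "\<And>k. moment P Y k = moment M Z k"
    and bound: "\<And>k. even k \<Longrightarrow> moment M Z k \<le> C ^ k"
  shows "distr P borel Y = distr M borel Z"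
proof (rule Levy_uniqueness)
  have "Y \<in> borel_measurable P" "Z \<in> borel_measurable M"
    using P M by (auto simp: all_moments_finite_def)
  then show "real_distribution (distr P borel Y)" "real_distribution (distr M borel Z)"
    using P(1) M(1) by (auto intro!: prob_space.real_distribution_distr)
  show "char (distr P borel Y) = char (distr M borel Z)"
  proof
    fix t
    let ?d = "cmod (char (distr P borel Y) t - char (distr M borel Z) t)"
    have le: "?d \<le> 4 * (inverse (fact (2*n)) * (C * \<bar>t\<bar>) ^ (2*n))" for n
    proof -
      let ?s = "\<Sum>k\<le>2*n. ((\<i> * t) ^ k / fact k) * moment M Z k"
      have "?d \<le> cmod (char (distr P borel Y) t - ?s) + cmod (char (distr M borel Z) t - ?s)"
        using norm_triangle_ineq4[of "char (distr P borel Y) t - ?s" "char (distr M borel Z) t - ?s"] by simp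
      also have "\<dots> \<le> 2 * (2 * (\<bar>t\<bar> ^ (2*n) / fact (2*n)) * moment M Z (2*n))"
        using char_moment_approx[OF P, of "2*n" t] char_moment_approx[OF M, of "2*n" t]
        by (simp only: eq) simp
      also have "\<dots> \<le> 2 * (2 * (\<bar>t\<bar> ^ (2*n) / fact (2*n)) * C ^ (2*n))"
        using bound[of "2*n"] by (intro mult_left_mono) auto
      finally show ?thesis by (simp add: field_simps power_mult_distrib)
    qed
    have "(\<lambda>n. inverse (fact n) * (C * \<bar>t\<bar>) ^ n) \<longlonglongrightarrow> 0"
      using summable_exp[of "C * \<bar>t\<bar>"] by (intro summable_LIMSEQ_zero)
    from LIMSEQ_subseq_LIMSEQ[OF this, of "\<lambda>n. 2 * n"]
    have "(\<lambda>n. inverse (fact (2*n)) * (C * \<bar>t\<bar>) ^ (2*n)) \<longlonglongrightarrow> 0"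
      by (simp add: strict_mono_def o_def)
    from tendsto_mult_left[OF this, of 4]
    have "(\<lambda>n. 4 * (inverse (fact (2*n)) * (C * \<bar>t\<bar>) ^ (2*n))) \<longlonglongrightarrow> 0" by simp
    then have "?d \<le> 0"
      by (rule LIMSEQ_le_const) (use le in auto)
    then show "char (distr P borel Y) t = char (distr M borel Z) t" by simp
  qed
qed

section \<open>The uniform law on lattice points and on an interval\<close>

text \<open>
  On each cell the integrand differs from its value at the midpoint by at most \<open>L h\<close>. This crude
  rate is enough here: the errors that it produces are of order \<open>N / 2\<^sup>N\<close> in total.
\<close>

lemma norm_midpoint_sum_diff_integral_le:
  fixes f :: "real \<Rightarrow> 'a::banach"
  assumes cont: "continuous_on UNIV f" and "h \<ge> 0"
    and lip: "\<And>x y. norm (f x - f y) \<le> L * \<bar>x - y\<bar>"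
  shows "norm (h *\<^sub>R (\<Sum>k<m. f (a + (real k + 1/2) * h)) - integral {a..a + real m * h} f)
           \<le> real m * (L * h * h)"
proof (induction m)
  case 0
  then show ?case by simp
next
  case (Suc m)
  let ?b = "a + real m * h" let ?c = "a + real (Suc m) * h" let ?x = "a + (real m + 1/2) * h"
  have bc: "a \<le> ?b" "?b \<le> ?c" using \<open>h \<ge> 0\<close> by (auto simp: algebra_simps)
  have L: "L \<ge> 0" using order_trans[OF norm_ge_zero lip[of 1 0]] by simp
  have int: "f integrable_on {u..v}" for u v
    using cont by (intro integrable_continuous_interval) (auto intro: continuous_on_subset)
  have "h *\<^sub>R f ?x - integral {?b..?c} f = integral {?b..?c} (\<lambda>y. f ?x - f y)"
    using bc int \<open>h \<ge> 0\<close> by (subst Henstock_Kurzweil_Integration.integral_diff) (auto simp: algebra_simps)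
  also have "norm \<dots> \<le> (L * h) * (?c - ?b)"
  proof (rule integral_bound)
    show "continuous_on {?b..?c} (\<lambda>y. f ?x - f y)"
      by (intro continuous_intros continuous_on_subset[OF cont]) auto
    fix y assume "y \<in> {?b..?c}"
    then have "\<bar>?x - y\<bar> \<le> h" using \<open>h \<ge> 0\<close> by (auto simp: algebra_simps abs_le_iff)
    then show "norm (f ?x - f y) \<le> L * h"
      using lip[of ?x y] L by (meson mult_left_mono order_trans)
  qed (use bc in auto)
  finally have step: "norm (h *\<^sub>R f ?x - integral {?b..?c} f) \<le> L * h * h"
    by (simp add: algebra_simps)
  have split: "integral {a..?c} f = integral {a..?b} f + integral {?b..?c} f"
    using bc int by (intro Henstock_Kurzweil_Integration.integral_combine[symmetric]) auto
  have "h *\<^sub>R (\<Sum>k<Suc m. f (a + (real k + 1/2) * h)) - integral {a..?c} f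
      = (h *\<^sub>R (\<Sum>k<m. f (a + (real k + 1/2) * h)) - integral {a..?b} f)
        + (h *\<^sub>R f ?x - integral {?b..?c} f)"
    by (simp only: split sum.lessThan_Suc scaleR_add_right) simp
  also have "norm \<dots> \<le> real m * (L * h * h) + L * h * h"
    by (rule norm_triangle_mono[OF Suc step])
  finally show ?case by (simp add: algebra_simps)
qed

lemma cmod_iexp_diff_le: "cmod (iexp x - iexp y) \<le> \<bar>x - y\<bar>"
proof -
  have "iexp x - iexp y = iexp y * (iexp (x - y) - 1)"
    by (simp add: algebra_simps flip: exp_add)
  then have "cmod (iexp x - iexp y) = cmod (iexp (x - y) - 1)"
    by (simp add: norm_mult)
  also have "\<dots> \<le> \<bar>x - y\<bar>"
    using iexp_approx1[of "x - y" 0] by simp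
  finally show ?thesis .
qed

definition unif3 :: "real measure" where
  "unif3 = density lborel (\<lambda>x. ennreal (indicator {-3..3} x / measure lborel {-3..3::real}))"

lemma unif3_eq_uniform_measure: "unif3 = uniform_measure lborel {-3..3}"
proof -
  have "ennreal (1 / 6) = 1 / 6"
    using divide_ennreal[of 1 6] by simp
  then show ?thesis
    unfolding unif3_def uniform_measure_def
    by (intro arg_cong[where f = "density lborel"]) (auto simp: indicator_def fun_eq_iff)
qed

lemma prob_space_unif3: "prob_space unif3"
  unfolding unif3_eq_uniform_measure by (rule prob_space_uniform_measure) auto

lemma sets_unif3 [measurable_cong, simp]: "sets unif3 = sets borel"
  by (simp add: unif3_def)

lemma space_unif3 [simp]: "space unif3 = UNIV"
  by (simp add: unif3_def)

lemma real_distribution_unif3: "real_distribution unif3"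
  by (simp add: real_distribution_def real_distribution_axioms_def prob_space_unif3)

lemma char_unif3: "char unif3 s = (1 / 6) *\<^sub>R integral {-3..3} (\<lambda>x. iexp (s * x))"
proof -
  have "char unif3 s = (\<integral>x. (1/6) *\<^sub>R (indicator {-3..3} x *\<^sub>R iexp (s * x)) \<partial>lborel)"
    unfolding char_def unif3_def
    by (subst integral_density) (auto simp: indicator_def intro!: Bochner_Integration.integral_cong)
  also have "\<dots> = (1/6) *\<^sub>R (LINT x:{-3..3}|lborel. iexp (s * x))"
    by (simp only: set_lebesgue_integral_def integral_scaleR_right)
  also have "(LINT x:{-3..3}|lborel. iexp (s * x)) = integral {-3..3} (\<lambda>x. iexp (s * x))"
    by (intro set_borel_integral_eq_integral borel_integrable_atLeastAtMost')
       (auto intro!: continuous_intros)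
  finally show ?thesis .
qed

definition centred :: "nat \<Rightarrow> int \<Rightarrow> real" where
  "centred j k = of_int k - (2 ^ j - 1) / 2"

lemma sum_int_atLeastAtMost_eq_sum_lessThan:
  "(\<Sum>k\<in>{0..2 ^ j - 1 :: int}. g k) = (\<Sum>k<2 ^ j. g (int k))"
  by (rule sum.reindex_bij_witness[of _ int nat]) (auto simp: nat_less_iff)

text \<open>
  The \<open>n = 2\<^sup>j\<close> values of \<open>6 / n\<close> times the centred coordinate are exactly the midpoints of the
  \<open>n\<close> equal cells of \<open>[-3, 3]\<close>, and the integrand has Lipschitz constant \<open>\<bar>s\<bar> n / 6\<close>.
\<close>

lemma char_centred_near_char_unif3:
  "cmod ((\<Sum>k\<in>{0..2 ^ j - 1}. iexp (s * centred j k)) / 2 ^ j - char unif3 (s * 2 ^ j / 6)) \<le> \<bar>s\<bar>"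
proof -
  define n :: real where "n = 2 ^ j"
  define f where "f = (\<lambda>x. iexp (s * n / 6 * x))"
  have n: "n > 0" by (simp add: n_def)
  have pt: "s * centred j (int k) = s * n / 6 * (-3 + (real k + 1/2) * (6 / n))" for k
    using n by (simp add: centred_def n_def field_simps)
  have "norm ((6 / n) *\<^sub>R (\<Sum>k<2 ^ j. f (-3 + (real k + 1/2) * (6 / n)))
          - integral {-3..-3 + real (2 ^ j) * (6 / n)} f)
       \<le> real (2 ^ j) * (\<bar>s * n / 6\<bar> * (6 / n) * (6 / n))"
  proof (rule norm_midpoint_sum_diff_integral_le)
    show "continuous_on UNIV f" unfolding f_def by (intro continuous_intros)
    fix x y show "norm (f x - f y) \<le> \<bar>s * n / 6\<bar> * \<bar>x - y\<bar>"
      unfolding f_def abs_mult[symmetric] right_diff_distrib by (rule cmod_iexp_diff_le)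
  qed (use n in auto)
  also have "\<dots> = 6 * \<bar>s\<bar>" using n by (simp add: n_def abs_mult)
  also have "-3 + real (2 ^ j) * (6 / n) = 3" by (simp add: n_def)
  also have "(\<Sum>k<2 ^ j. f (-3 + (real k + 1/2) * (6 / n))) = (\<Sum>k\<in>{0..2 ^ j - 1}. iexp (s * centred j k))"
    unfolding sum_int_atLeastAtMost_eq_sum_lessThan f_def by (intro sum.cong refl) (simp only: pt)
  finally have *: "cmod ((6 / n) *\<^sub>R (\<Sum>k\<in>{0..2 ^ j - 1}. iexp (s * centred j k)) - integral {-3..3} f) \<le> 6 * \<bar>s\<bar>" .
  have "char unif3 (s * 2 ^ j / 6) = (1/6) *\<^sub>R integral {-3..3} f"
    unfolding char_unif3 f_def n_def by simp
  then have "(\<Sum>k\<in>{0..2 ^ j - 1}. iexp (s * centred j k)) / 2 ^ j - char unif3 (s * 2 ^ j / 6)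
     = (1/6) *\<^sub>R ((6 / n) *\<^sub>R (\<Sum>k\<in>{0..2 ^ j - 1}. iexp (s * centred j k)) - integral {-3..3} f)"
    by (simp add: n_def scaleR_diff_right scaleR_conv_of_real)
  then have "cmod ((\<Sum>k\<in>{0..2 ^ j - 1}. iexp (s * centred j k)) / 2 ^ j - char unif3 (s * 2 ^ j / 6))
     = 1/6 * cmod ((6 / n) *\<^sub>R (\<Sum>k\<in>{0..2 ^ j - 1}. iexp (s * centred j k)) - integral {-3..3} f)"
    by (simp only: norm_scaleR)
  with * show ?thesis by simp
qed

section \<open>The finite model: mean, variance and characteristic function\<close>

lemma finite_Omega: "finite (Omega N)"
  unfolding Omega_def by (intro finite_PiE) auto

lemma Omega_nonempty: "Omega N \<noteq> {}"
  using card_Omega[of N] by auto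

lemma prob_space_P_N: "prob_space (P_N N)"
  unfolding P_N_def by (rule prob_space_uniform_count_measure[OF finite_Omega Omega_nonempty])

lemma measurable_P_N [measurable]: "f \<in> borel_measurable (P_N N)"
  by (simp add: P_N_def measurable_def sets_uniform_count_measure space_uniform_count_measure)

lemma integrable_P_N:
  fixes f :: "_ \<Rightarrow> 'b::{banach, second_countable_topology}"
  shows "integrable (P_N N) f"
  unfolding P_N_def uniform_count_measure_def by (rule integrable_point_measure_finite[OF finite_Omega])

text \<open>
  Independence of the coordinates, as distributivity of products over sums. It gives the mean, the
  covariances and the characteristic function.
\<close>

lemma integral_P_N_prod:
  fixes f :: "nat \<Rightarrow> int \<Rightarrow> 'b::{banach, second_countable_topology, real_normed_field}"
  shows "(\<integral>\<omega>. (\<Prod>j=1..N. f j (\<omega> j)) \<partial>P_N N) = (\<Prod>j=1..N. (\<Sum>k\<in>{0..2 ^ j - 1}. f j k) / 2 ^ j)"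
proof -
  have "(\<integral>\<omega>. (\<Prod>j=1..N. f j (\<omega> j)) \<partial>P_N N)
      = (\<Sum>\<omega>\<in>Omega N. (1 / card (Omega N)) *\<^sub>R (\<Prod>j=1..N. f j (\<omega> j)))"
    unfolding P_N_def uniform_count_measure_def
    by (subst lebesgue_integral_point_measure_finite) (auto simp: finite_Omega)
  also have "\<dots> = (\<Sum>\<omega>\<in>Omega N. (\<Prod>j=1..N. f j (\<omega> j))) / of_nat (card (Omega N))"
    by (simp add: scaleR_conv_of_real sum_divide_distrib)
  also have "(\<Sum>\<omega>\<in>Omega N. (\<Prod>j=1..N. f j (\<omega> j))) = (\<Prod>j=1..N. \<Sum>k\<in>{0..2 ^ j - 1}. f j k)"
    unfolding Omega_def by (rule prod_sum_PiE[symmetric]) auto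
  also have "of_nat (card (Omega N)) = (\<Prod>j=1..N. (2::'b) ^ j)"
    unfolding Omega_def by (subst card_PiE) (simp_all add: nat_power_eq)
  finally show ?thesis by (simp add: prod_dividef)
qed

lemma sum_centred: "(\<Sum>k\<in>{0..2 ^ j - 1}. centred j k) = 0"
proof -
  \<comment> \<open>The centre \<open>a\<close> is decoupled from the number \<open>n\<close> of terms so that induction on \<open>n\<close> works.\<close>
  have "(\<Sum>k<n. real k - (a - 1) / 2) = real n * (real n - a) / 2" for n :: nat and a :: real
    by (induction n) (auto simp: field_simps)
  from this[of "2^j" "2^j"] show ?thesis
    by (simp add: sum_int_atLeastAtMost_eq_sum_lessThan centred_def)
qed

lemma sum_centred_sq: "(\<Sum>k\<in>{0..2 ^ j - 1}. (centred j k)\<^sup>2) = 2 ^ j * ((4 ^ j - 1) / 12)"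
proof -
  have *: "(\<Sum>k<n. (real k - (a - 1) / 2)\<^sup>2)
      = real n * (real n - 1) * (2 * real n - 1) / 6 - (a - 1) * (real n * (real n - 1) / 2)
        + real n * (a - 1)\<^sup>2 / 4" for n :: nat and a :: real
    by (induction n) (simp_all add: field_simps power2_eq_square)
  have "(4::real) ^ j = (2 ^ j)\<^sup>2" by (simp add: power2_eq_square flip: power_mult_distrib)
  with *[of "2^j" "2^j"] show ?thesis
    by (simp add: sum_int_atLeastAtMost_eq_sum_lessThan centred_def) (simp add: field_simps power2_eq_square)
qed

lemma expectation_centred:
  assumes "i \<in> {1..N}"
  shows "(\<integral>\<omega>. centred i (\<omega> i) \<partial>P_N N) = 0"
proof -
  let ?f = "\<lambda>l k. if l = i then centred i k else 1"
  have "(\<integral>\<omega>. centred i (\<omega> i) \<partial>P_N N) = (\<integral>\<omega>. (\<Prod>l=1..N. ?f l (\<omega> l)) \<partial>P_N N)"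
    using assms by (simp add: prod.delta)
  also have "\<dots> = 0"
    using integral_P_N_prod[of N ?f] assms by (simp, intro prod_zero bexI[of _ i]) (auto simp: sum_centred)
  finally show ?thesis .
qed

lemma expectation_centred_mult:
  assumes "i \<in> {1..N}" "j \<in> {1..N}"
  shows "(\<integral>\<omega>. centred i (\<omega> i) * centred j (\<omega> j) \<partial>P_N N) = (if i = j then (4 ^ i - 1) / 12 else 0)"
proof -
  let ?f = "\<lambda>l k. (if l = i then centred i k else 1) * (if l = j then centred j k else 1)"
  have "(\<integral>\<omega>. centred i (\<omega> i) * centred j (\<omega> j) \<partial>P_N N) = (\<integral>\<omega>. (\<Prod>l=1..N. ?f l (\<omega> l)) \<partial>P_N N)"
    using assms by (simp add: prod.distrib prod.delta)
  also have "\<dots> = (\<Prod>l=1..N. (\<Sum>k\<in>{0..2 ^ l - 1}. ?f l k) / 2 ^ l)"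
    by (rule integral_P_N_prod)
  also have "\<dots> = (if i = j then (4 ^ i - 1) / 12 else 0)"
  proof (cases "i = j")
    case False
    then show ?thesis
      using assms by (simp, intro prod_zero bexI[of _ i]) (auto simp: sum_centred)
  next
    case True
    have "(\<Sum>k\<in>{0..2 ^ l - 1}. ?f l k) / 2 ^ l = (if l = i then (4 ^ i - 1) / 12 else 1)" for l
      using True sum_centred_sq[of i] by (auto simp: power2_eq_square)
    then show ?thesis using True assms by (simp add: prod.delta)
  qed
  finally show ?thesis .
qed

lemma mu_N_eq: "mu_N N = (\<Sum>j=1..N. (2 ^ j - 1) / 2)"
proof -
  interpret prob_space "P_N N" by (rule prob_space_P_N)
  have "mu_N N = (\<integral>\<omega>. (\<Sum>j=1..N. centred j (\<omega> j)) + (\<Sum>j=1..N. (2 ^ j - 1) / 2) \<partial>P_N N)"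
    by (simp add: mu_N_def Z_N_def centred_def flip: sum.distrib)
  also have "\<dots> = (\<Sum>j=1..N. (2 ^ j - 1) / 2)"
    by (simp add: integrable_P_N expectation_centred prob_space)
  finally show ?thesis .
qed

lemma Z_N_minus_mu_N: "Z_N N \<omega> - mu_N N = (\<Sum>j=1..N. centred j (\<omega> j))"
  by (simp add: mu_N_eq Z_N_def centred_def flip: sum_subtractf)

lemma sigma_N_eq: "sigma_N N = sqrt ((4 ^ Suc N - 4) / 36 - real N / 12)"
proof -
  have "(\<integral>\<omega>. (Z_N N \<omega> - mu_N N)\<^sup>2 \<partial>P_N N) = (\<Sum>i=1..N. \<Sum>j=1..N. if i = j then (4 ^ i - 1) / 12 else 0)"
    unfolding Z_N_minus_mu_N power2_eq_square sum_product
    by (simp add: integrable_P_N expectation_centred_mult)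
  also have "\<dots> = (\<Sum>i=1..N. (4 ^ i - 1) / 12)"
    by (intro sum.cong refl) (simp add: sum.delta)
  also have "\<dots> = (4 ^ Suc N - 4) / 36 - real N / 12"
    by (induction N) (auto simp: field_simps)
  finally show ?thesis by (simp add: sigma_N_def)
qed

lemma char_Zhat_N:
  "char (distr (P_N N) borel (Zhat_N N)) t =
     (\<Prod>j=1..N. (\<Sum>k\<in>{0..2 ^ j - 1}. iexp (t / sigma_N N * centred j k)) / 2 ^ j)"
proof -
  have "char (distr (P_N N) borel (Zhat_N N)) t = (\<integral>\<omega>. iexp (t * Zhat_N N \<omega>) \<partial>P_N N)"
    by (simp add: char_def integral_distr)
  also have "\<dots> = (\<integral>\<omega>. (\<Prod>j=1..N. iexp (t / sigma_N N * centred j (\<omega> j))) \<partial>P_N N)"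
    by (simp add: Zhat_N_def Z_N_minus_mu_N sum_distrib_left sum_divide_distrib flip: exp_sum)
  finally show ?thesis
    using integral_P_N_prod[of N "\<lambda>j k. iexp (t / sigma_N N * centred j k)"] by simp
qed

lemma scale_tendsto_1: "(\<lambda>N. 2 ^ N / (3 * sigma_N N)) \<longlonglongrightarrow> 1"
proof -
  let ?v = "\<lambda>N. (4 ^ Suc N - 4) / 36 - real N / 12"
  have "(\<lambda>N. 9 * ?v N / 4 ^ N) \<longlonglongrightarrow> 1"
    unfolding power_Suc by real_asymp
  then have "(\<lambda>N. 1 / sqrt (9 * ?v N / 4 ^ N)) \<longlonglongrightarrow> 1 / sqrt 1"
    by (intro tendsto_divide tendsto_real_sqrt tendsto_const) auto
  moreover have "sqrt (9 * ?v N / 4 ^ N) = 3 * sigma_N N / 2 ^ N" for N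
  proof -
    have "sqrt 9 = (3::real)" by (rule real_sqrt_unique) auto
    then show ?thesis
      by (simp only: sigma_N_eq real_sqrt_mult real_sqrt_divide real_sqrt_power real_sqrt_four)
  qed
  ultimately show ?thesis by simp
qed

lemma error_tendsto_0: "(\<lambda>N. real N * \<bar>t / sigma_N N\<bar>) \<longlonglongrightarrow> 0"
proof -
  have "(\<lambda>N. real N * 3 / 2 ^ N) \<longlonglongrightarrow> 0" by real_asymp
  from tendsto_mult[OF this scale_tendsto_1]
  have "(\<lambda>N. real N / sigma_N N) \<longlonglongrightarrow> 0" by simp
  from tendsto_rabs_zero[OF tendsto_mult_right_zero[OF this, of t]]
  show ?thesis by (simp add: abs_mult mult.commute)
qed

section \<open>Dyadic series with bounded coefficients\<close>

lemma
  fixes u :: "nat \<Rightarrow> real"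
  assumes "\<And>i. \<bar>u i\<bar> \<le> C"
  shows summable_dyadic: "summable (\<lambda>i. u i / 2 ^ Suc i)"
    and abs_suminf_dyadic_le: "\<bar>\<Sum>i. u i / 2 ^ Suc i\<bar> \<le> C"
proof -
  have C: "(\<lambda>i. C / 2 ^ Suc i) sums C"
    using sums_mult[OF power_half_series, of C] by (simp add: power_divide)
  have le: "norm (u i / 2 ^ Suc i) \<le> C / 2 ^ Suc i" for i
    using assms[of i] by (simp add: divide_right_mono)
  show "summable (\<lambda>i. u i / 2 ^ Suc i)"
    by (rule summable_comparison_test'[OF sums_summable[OF C], of 0]) (rule le)
  show "\<bar>\<Sum>i. u i / 2 ^ Suc i\<bar> \<le> C"
    using norm_suminf_le[OF le sums_summable[OF C]] sums_unique[OF C] by simp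
qed

text \<open>
  A series whose first \<open>n\<close> coefficients are small is small, as the tail carries a factor
  \<open>2\<^sup>-\<^sup>n\<close>. This is what shows that every point of the interval is in the support.
\<close>

lemma abs_suminf_dyadic_le_add:
  fixes u :: "nat \<Rightarrow> real"
  assumes C: "\<And>i. \<bar>u i\<bar> \<le> C" and \<delta>: "\<And>i. i < n \<Longrightarrow> \<bar>u i\<bar> \<le> \<delta>" "0 \<le> \<delta>"
  shows "\<bar>\<Sum>i. u i / 2 ^ Suc i\<bar> \<le> \<delta> + C / 2 ^ n"
proof -
  let ?w = "\<lambda>i. if i < n then u i else 0"
  have "(\<Sum>i. ?w i / 2 ^ Suc i) = (\<Sum>i<n. ?w i / 2 ^ Suc i)"
    by (rule suminf_finite) auto
  then have "(\<Sum>i<n. u i / 2 ^ Suc i) = (\<Sum>i. ?w i / 2 ^ Suc i)" by simp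
  moreover have "\<bar>\<Sum>i. ?w i / 2 ^ Suc i\<bar> \<le> \<delta>"
    by (rule abs_suminf_dyadic_le) (use \<delta> in auto)
  moreover have "(\<Sum>i. u (i + n) / 2 ^ Suc (i + n)) = (\<Sum>i. u (i + n) / 2 ^ Suc i) / 2 ^ n"
    using suminf_divide[OF summable_dyadic, of "\<lambda>i. u (i + n)" C "2 ^ n"] C
    by (simp add: power_add field_simps)
  moreover have "\<bar>(\<Sum>i. u (i + n) / 2 ^ Suc i) / 2 ^ n\<bar> \<le> C / 2 ^ n"
    using abs_suminf_dyadic_le[of "\<lambda>i. u (i + n)" C] C by (simp add: divide_right_mono)
  ultimately show ?thesis
    using suminf_split_initial_segment[OF summable_dyadic[of u, OF C], where k = n]
    by linarith
qed

section \<open>The random series\<close>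

locale iid_uniform = prob_space P for P :: "'a measure" +
  fixes U :: "nat \<Rightarrow> 'a \<Rightarrow> real"
  assumes iid: "iid_uniform_3 P U"
begin

definition partial_sum :: "nat \<Rightarrow> 'a \<Rightarrow> real" where
  "partial_sum n \<omega> = (\<Sum>i=1..n. U i \<omega> / 2 ^ i)"

definition series :: "'a \<Rightarrow> real" where
  "series \<omega> = (\<Sum>i. U (Suc i) \<omega> / 2 ^ Suc i)"

lemma distributed_U:
  "i \<ge> 1 \<Longrightarrow> distributed P lborel (U i)
     (\<lambda>x. ennreal (indicator {-3..3} x / measure lborel {-3..3::real}))"
  using iid by (simp add: iid_uniform_3_def)

lemma indep_U: "indep_vars (\<lambda>_. borel) U {1..}"
  using iid by (simp add: iid_uniform_3_def)

lemma measurable_U: "i \<ge> 1 \<Longrightarrow> U i \<in> borel_measurable P"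
  using distributed_measurable[OF distributed_U] by (simp add: measurable_lborel1)

lemma measurable_U_Suc [measurable]: "U (Suc i) \<in> borel_measurable P"
  by (rule measurable_U) simp

lemma measurable_partial_sum [measurable]: "partial_sum n \<in> borel_measurable P"
  unfolding partial_sum_def[abs_def] by (auto intro!: borel_measurable_sum borel_measurable_divide measurable_U)

lemma measurable_series [measurable]: "series \<in> borel_measurable P"
  unfolding series_def[abs_def] by measurable

lemma distr_U: "i \<ge> 1 \<Longrightarrow> distr P borel (U i) = unif3"
  unfolding unif3_def distributed_distr_eq_density[OF distributed_U, symmetric]
  by (rule distr_cong) auto

lemma AE_U_bounded: "AE \<omega> in P. \<forall>i. \<bar>U (Suc i) \<omega>\<bar> \<le> 3"
proof (subst AE_all_countable, intro allI)
  fix i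
  have "AE x in unif3. \<bar>x\<bar> \<le> 3"
    unfolding unif3_def by (subst AE_density) (auto simp: indicator_def)
  then have "AE x in distr P borel (U (Suc i)). \<bar>x\<bar> \<le> 3"
    by (subst distr_U) auto
  then show "AE \<omega> in P. \<bar>U (Suc i) \<omega>\<bar> \<le> 3"
    by (subst (asm) AE_distr_iff) auto
qed

lemma AE_summable: "AE \<omega> in P. summable (\<lambda>i. U (Suc i) \<omega> / 2 ^ Suc i)"
  using AE_U_bounded by eventually_elim (rule summable_dyadic, blast)

lemma AE_series_bounded: "AE \<omega> in P. \<bar>series \<omega>\<bar> \<le> 3"
  using AE_U_bounded by eventually_elim (unfold series_def, rule abs_suminf_dyadic_le, blast)

lemma AE_partial_sum_tendsto: "AE \<omega> in P. (\<lambda>n. partial_sum n \<omega>) \<longlonglongrightarrow> series \<omega>"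
  using AE_summable
proof eventually_elim
  case (elim \<omega>)
  have "partial_sum n \<omega> = (\<Sum>i<n. U (Suc i) \<omega> / 2 ^ Suc i)" for n
    unfolding partial_sum_def One_nat_def by (rule sum.atLeast1_atMost_eq)
  with summable_LIMSEQ[OF elim] show ?case by (simp only: series_def)
qed

lemma char_partial_sum: "char (distr P borel (partial_sum n)) t = (\<Prod>i=1..n. char unif3 (t / 2 ^ i))"
proof -
  have "indep_vars (\<lambda>_. borel) (\<lambda>i \<omega>. U i \<omega> / 2 ^ i) {1..n}"
    by (rule indep_vars_compose2[OF indep_vars_subset[OF indep_U]]) auto
  then have "char (distr P borel (partial_sum n)) t = (\<Prod>i=1..n. char (distr P borel (\<lambda>\<omega>. U i \<omega> / 2 ^ i)) t)"
    unfolding partial_sum_def[abs_def] by (rule char_distr_sum)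
  also have "char (distr P borel (\<lambda>\<omega>. U i \<omega> / 2 ^ i)) t = char unif3 (t / 2 ^ i)" if "i \<in> {1..n}" for i
  proof -
    have [measurable]: "U i \<in> borel_measurable P" using that by (intro measurable_U) auto
    have "unif3 = distr P borel (U i)" using that by (intro distr_U[symmetric]) auto
    show ?thesis
      by (simp only: \<open>unif3 = distr P borel (U i)\<close>) (simp add: char_def integral_distr)
  qed
  then have "(\<Prod>i=1..n. char (distr P borel (\<lambda>\<omega>. U i \<omega> / 2 ^ i)) t) = (\<Prod>i=1..n. char unif3 (t / 2 ^ i))"
    by (rule prod.cong[OF refl])
  finally show ?thesis .
qed

text \<open>
  The factor \<open>c n\<close> absorbs that \<open>\<sigma>\<^sub>N\<close> is only asymptotically equal to \<open>2\<^sup>N / 3\<close>.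
\<close>

lemma char_scaled_partial_sum_tendsto:
  assumes "c \<longlonglongrightarrow> 1"
  shows "(\<lambda>n. char (distr P borel (partial_sum n)) (t * c n)) \<longlonglongrightarrow> char (distr P borel series) t"
proof -
  have "(\<lambda>n. \<integral>\<omega>. iexp (t * c n * partial_sum n \<omega>) \<partial>P) \<longlonglongrightarrow> (\<integral>\<omega>. iexp (t * series \<omega>) \<partial>P)"
  proof (rule integral_dominated_convergence[where w = "\<lambda>_. 1"])
    show "AE \<omega> in P. (\<lambda>n. iexp (t * c n * partial_sum n \<omega>)) \<longlonglongrightarrow> iexp (t * series \<omega>)"
      using AE_partial_sum_tendsto
    proof eventually_elim
      case (elim \<omega>)
      have "(\<lambda>n. t * c n * partial_sum n \<omega>) \<longlonglongrightarrow> t * 1 * series \<omega>"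
        by (intro tendsto_mult tendsto_const elim assms)
      then have "(\<lambda>n. iexp (t * c n * partial_sum n \<omega>)) \<longlonglongrightarrow> iexp (t * 1 * series \<omega>)"
        by (rule isCont_tendsto_compose[OF isCont_iexp])
      then show ?case by simp
    qed
  qed auto
  then show ?thesis by (simp add: char_def integral_distr)
qed

text \<open>
  The coordinate \<open>j\<close> of the finite model is paired with the summand \<open>N + 1 - j\<close> of the series.
\<close>

lemma cmod_char_Zhat_N_minus_char_partial_sum_le:
  "cmod (char (distr (P_N N) borel (Zhat_N N)) t
         - char (distr P borel (partial_sum N)) (t * (2 ^ N / (3 * sigma_N N)))) \<le> real N * \<bar>t / sigma_N N\<bar>"
proof -
  let ?s = "t / sigma_N N"
  have eq: "t * (2 ^ N / (3 * sigma_N N)) / 2 ^ (N + 1 - j) = ?s * 2 ^ j / 6" if "j \<in> {1..N}" for j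
  proof -
    have "(2::real) ^ N * 2 = 2 ^ j * 2 ^ (N + 1 - j)"
      using that by (simp flip: power_add power_Suc2)
    then have "(2::real) ^ N = 2 ^ j * 2 ^ (N + 1 - j) / 2" by simp
    then show ?thesis by (simp only:) simp
  qed
  have "char (distr P borel (partial_sum N)) (t * (2 ^ N / (3 * sigma_N N)))
      = (\<Prod>j=1..N. char unif3 (t * (2 ^ N / (3 * sigma_N N)) / 2 ^ (N + 1 - j)))"
    unfolding char_partial_sum by (subst prod.atLeastAtMost_rev) simp
  also have "\<dots> = (\<Prod>j=1..N. char unif3 (?s * 2 ^ j / 6))"
    by (intro prod.cong refl arg_cong[where f = "char unif3"] eq)
  finally have partial_sum: "char (distr P borel (partial_sum N)) (t * (2 ^ N / (3 * sigma_N N)))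
      = (\<Prod>j=1..N. char unif3 (?s * 2 ^ j / 6))" .
  have "cmod ((\<Sum>k\<in>{0..2 ^ j - 1}. iexp (?s * centred j k)) / 2 ^ j) \<le> 1" for j
  proof -
    have "cmod (\<Sum>k\<in>{0..2 ^ j - 1}. iexp (?s * centred j k)) \<le> (\<Sum>k\<in>{0..2 ^ j - 1 :: int}. 1)"
      by (rule sum_norm_le) simp
    then show ?thesis by (simp add: norm_divide norm_power nat_power_eq)
  qed
  then have "cmod ((\<Prod>j=1..N. (\<Sum>k\<in>{0..2 ^ j - 1}. iexp (?s * centred j k)) / 2 ^ j)
               - (\<Prod>j=1..N. char unif3 (?s * 2 ^ j / 6)))
        \<le> (\<Sum>j=1..N. cmod ((\<Sum>k\<in>{0..2 ^ j - 1}. iexp (?s * centred j k)) / 2 ^ j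
               - char unif3 (?s * 2 ^ j / 6)))"
    by (intro norm_prod_diff real_distribution.cmod_char_le_1[OF real_distribution_unif3])
  also have "\<dots> \<le> (\<Sum>j=1..N. \<bar>?s\<bar>)"
    by (intro sum_mono char_centred_near_char_unif3)
  finally show ?thesis unfolding char_Zhat_N partial_sum by simp
qed

lemma char_Zhat_N_tendsto:
  "(\<lambda>N. char (distr (P_N N) borel (Zhat_N N)) t) \<longlonglongrightarrow> char (distr P borel series) t"
proof -
  let ?c = "\<lambda>N. char (distr P borel (partial_sum N)) (t * (2 ^ N / (3 * sigma_N N)))"
  have "(\<lambda>N. char (distr (P_N N) borel (Zhat_N N)) t - ?c N) \<longlonglongrightarrow> 0"
    by (rule Lim_null_comparison[OF _ error_tendsto_0[of t]])
       (simp only: cmod_char_Zhat_N_minus_char_partial_sum_le eventually_sequentially, simp)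
  from tendsto_add[OF this char_scaled_partial_sum_tendsto[OF scale_tendsto_1, of t]]
  show ?thesis by (simp only: diff_add_cancel add_0)
qed

lemma distr_weak_limit_eq_distr_series:
  assumes "prob_space M" "Z \<in> borel_measurable M"
    and "weak_conv_m (\<lambda>N. distr (P_N N) borel (Zhat_N N)) (distr M borel Z)"
  shows "distr M borel Z = distr P borel series"
proof (rule Levy_uniqueness)
  show M: "real_distribution (distr M borel Z)"
    using assms by (intro prob_space.real_distribution_distr)
  show "real_distribution (distr P borel series)" by simp
  show "char (distr M borel Z) = char (distr P borel series)"
  proof
    fix t
    have "real_distribution (distr (P_N N) borel (Zhat_N N))" for N
      by (intro prob_space.real_distribution_distr prob_space_P_N measurable_P_N)
    from levy_continuity1[OF this M assms(3)]
    show "char (distr M borel Z) t = char (distr P borel series) t"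
      by (rule LIMSEQ_unique) (rule char_Zhat_N_tendsto)
  qed
qed

text \<open>
  The index set ends at \<open>Suc n\<close> only because the product rule for independent variables requires a
  nonempty one.
\<close>

lemma prob_U_near_pos:
  assumes "x \<in> {-3..3}" "\<delta> > 0"
  shows "prob (\<Inter>i\<in>{1..Suc n}. U i -` {x - \<delta>..x + \<delta>} \<inter> space P) > 0"
proof -
  have "emeasure unif3 {x - \<delta>..x + \<delta>} = emeasure lborel {max (-3) (x - \<delta>)..min 3 (x + \<delta>)} / 6"
    unfolding unif3_eq_uniform_measure by (subst emeasure_uniform_measure) auto
  also have "\<dots> > 0"
    using assms by (auto simp: ennreal_zero_less_divide)
  finally have "emeasure unif3 {x - \<delta>..x + \<delta>} > 0" .
  then have pos: "measure unif3 {x - \<delta>..x + \<delta>} > 0"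
    using finite_measure.emeasure_eq_measure[OF prob_space.finite_measure[OF prob_space_unif3]]
    by simp
  have "prob (\<Inter>i\<in>{1..Suc n}. U i -` {x - \<delta>..x + \<delta>} \<inter> space P)
      = (\<Prod>i\<in>{1..Suc n}. prob (U i -` {x - \<delta>..x + \<delta>} \<inter> space P))"
    by (rule indep_varsD[OF indep_U]) auto
  also have "\<dots> = (\<Prod>i\<in>{1..Suc n}. measure unif3 {x - \<delta>..x + \<delta>})"
  proof (rule prod.cong[OF refl])
    fix i assume "i \<in> {1..Suc n}"
    then have "i \<ge> 1" by simp
    then show "prob (U i -` {x - \<delta>..x + \<delta>} \<inter> space P) = measure unif3 {x - \<delta>..x + \<delta>}"
      using measure_distr[OF measurable_U, of i "{x - \<delta>..x + \<delta>}"] by (simp add: distr_U)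
  qed
  also have "\<dots> > 0" using pos by (intro prod_pos)
  finally show ?thesis .
qed

lemma dist_support_series: "dist_support (distr P borel series) = {-3..3}"
proof (intro equalityI subsetI)
  fix x assume x: "x \<in> dist_support (distr P borel series)"
  have "AE y in distr P borel series. y \<notin> - {-3..3}"
    using AE_series_bounded by (subst AE_distr_iff) (auto elim!: eventually_mono)
  then have "emeasure (distr P borel series) (- {-3..3}) = 0"
    by (subst (asm) AE_iff_measurable[of "- {-3..3}"]) auto
  moreover have "open (- {-3..3::real})" by auto
  ultimately show "x \<in> {-3..3}"
    using x unfolding dist_support_def by force
next
  fix x :: real assume x: "x \<in> {-3..3}"
  show "x \<in> dist_support (distr P borel series)"
    unfolding dist_support_def
  proof (safe)
    fix V :: "real set" assume V: "open V" "x \<in> V"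
    then obtain \<epsilon> where \<epsilon>: "\<epsilon> > 0" "ball x \<epsilon> \<subseteq> V" using openE by blast
    \<comment> \<open>The tail beyond \<open>n\<close> is at most \<open>6 / 2\<^sup>n\<close>, since \<open>\<bar>U\<^sub>i - x\<bar> \<le> 6\<close>; half of \<open>\<epsilon>\<close> is left for it.\<close>
    obtain n where n: "(1/2) ^ n < \<epsilon> / 12"
      using real_arch_pow_inv[of "\<epsilon> / 12" "1/2"] \<epsilon> by auto
    let ?E = "\<Inter>i\<in>{1..Suc n}. U i -` {x - \<epsilon>/2..x + \<epsilon>/2} \<inter> space P"
    have x_series: "(\<lambda>i. x / 2 ^ Suc i) sums x"
      using sums_mult[OF power_half_series, of x] by (simp add: power_divide)
    have "AE \<omega> in P. \<omega> \<in> ?E \<longrightarrow> \<omega> \<in> series -` V \<inter> space P"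
      using AE_U_bounded
    proof eventually_elim
      case (elim \<omega>)
      show ?case
      proof
        assume E: "\<omega> \<in> ?E"
        have "series \<omega> - x = (\<Sum>i. U (Suc i) \<omega> / 2 ^ Suc i - x / 2 ^ Suc i)"
          using suminf_diff[OF summable_dyadic[of "\<lambda>i. U (Suc i) \<omega>" 3] sums_summable[OF x_series]]
            elim sums_unique[OF x_series] by (simp add: series_def)
        also have "\<dots> = (\<Sum>i. (U (Suc i) \<omega> - x) / 2 ^ Suc i)"
          by (simp only: diff_divide_distrib)
        also have "\<bar>\<dots>\<bar> \<le> \<epsilon> / 2 + 6 / 2 ^ n"
        proof (rule abs_suminf_dyadic_le_add)
          fix i
          show "\<bar>U (Suc i) \<omega> - x\<bar> \<le> 6"
            using elim[rule_format, of i] x by (auto simp: abs_le_iff)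
          show "\<bar>U (Suc i) \<omega> - x\<bar> \<le> \<epsilon> / 2" if "i < n"
          proof -
            have "Suc i \<in> {1..Suc n}" using that by auto
            with E have "U (Suc i) \<omega> \<in> {x - \<epsilon>/2..x + \<epsilon>/2}" by blast
            then show ?thesis by (simp only: abs_le_iff atLeastAtMost_iff) linarith
          qed
        qed (use \<epsilon> in auto)
        also have "\<dots> < \<epsilon>" using n by (simp add: power_divide field_simps)
        finally have "series \<omega> \<in> ball x \<epsilon>" by (simp add: dist_real_def abs_minus_commute)
        with \<epsilon> E show "\<omega> \<in> series -` V \<inter> space P" by auto
      qed
    qed
    then have "emeasure P ?E \<le> emeasure P (series -` V \<inter> space P)"
      using V by (intro emeasure_mono_AE) (auto intro!: measurable_sets[OF measurable_series])
    moreover have "emeasure P ?E > 0"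
      using prob_U_near_pos[OF x, of "\<epsilon>/2" n] \<epsilon> by (simp add: emeasure_eq_measure)
    ultimately show "emeasure (distr P borel series) V > 0"
      using V by (simp add: emeasure_distr)
  qed
qed

end

text \<open>The infinite product of the uniform law realises the series, so that it exists at all.\<close>

lemma iid_uniform_product:
  "iid_uniform (Pi\<^sub>M (UNIV :: nat set) (\<lambda>_. unif3)) (\<lambda>i \<omega>. \<omega> i)"
proof -
  let ?P = "Pi\<^sub>M (UNIV :: nat set) (\<lambda>_. unif3)"
  interpret prob_space ?P
    by (intro prob_space_PiM prob_space_unif3)
  have sets: "sets ?P = sets (Pi\<^sub>M UNIV (\<lambda>_. borel))"
    by (intro sets_PiM_cong) auto
  have meas: "(\<lambda>\<omega>. \<omega> i) \<in> borel_measurable ?P" for i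
    using measurable_component_singleton[of i UNIV "\<lambda>_. unif3"] by simp
  have comp: "distr ?P borel (\<lambda>\<omega>. \<omega> i) = unif3" for i
    using distr_PiM_component[of UNIV "\<lambda>_. unif3" i] prob_space_unif3
    by (simp cong: distr_cong)
  have "indep_vars (\<lambda>_. borel) (\<lambda>i \<omega>. \<omega> i) UNIV"
    by (subst indep_vars_iff_distr_eq_PiM') (simp_all add: meas comp restrict_UNIV distr_id2[OF sets[symmetric]])
  then have "indep_vars (\<lambda>_. borel) (\<lambda>i \<omega>. \<omega> i) {1..}"
    by (rule indep_vars_subset) auto
  moreover have "distributed ?P lborel (\<lambda>\<omega>. \<omega> i)
     (\<lambda>x. ennreal (indicator {-3..3} x / measure lborel {-3..3::real}))" for i
  proof -
    have "distr ?P lborel (\<lambda>\<omega>. \<omega> i) = distr ?P borel (\<lambda>\<omega>. \<omega> i)"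
      by (rule distr_cong) auto
    then show ?thesis
      using comp[of i] meas[of i] by (simp add: distributed_def unif3_def measurable_lborel1)
  qed
  ultimately have "iid_uniform_3 ?P (\<lambda>i \<omega>. \<omega> i)"
    by (simp add: iid_uniform_3_def)
  then show ?thesis
    by unfold_locales
qed

lemma (in prob_space) all_moments_finite_bounded:
  assumes "Z \<in> borel_measurable M" "AE \<omega> in M. \<bar>Z \<omega>\<bar> \<le> C"
  shows "all_moments_finite M Z" "moment M Z k \<le> C ^ k"
proof -
  have AE: "AE \<omega> in M. norm (Z \<omega> ^ k) \<le> C ^ k" for k
    using assms(2) by eventually_elim (simp add: power_abs power_mono)
  have int: "integrable M (\<lambda>\<omega>. Z \<omega> ^ k)" for k
    using assms(1) AE by (intro integrable_const_bound[of _ "C ^ k"]) auto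
  show "all_moments_finite M Z" using assms(1) int by (simp add: all_moments_finite_def)
  have "moment M Z k \<le> (\<integral>\<omega>. C ^ k \<partial>M)"
    unfolding moment_def using AE[of k]
    by (intro integral_mono_AE int) (auto elim!: eventually_mono)
  then show "moment M Z k \<le> C ^ k" by (simp add: prob_space)
qed

section \<open>Identification and characterisation of the limit\<close>

theorem proposition4p1:
  fixes M :: "'a measure" and Z :: "'a \<Rightarrow> real" and \<Lambda> :: "real \<Rightarrow> real"
  assumes "prob_space M"
    and "Z \<in> borel_measurable M"
    and "weak_conv_m (\<lambda>N. distr (P_N N) borel (Zhat_N N)) (distr M borel Z)"
    and "\<Lambda> = cdf (distr M borel Z)"
  shows
    "all_moments_finite M Z \<and>
     (\<forall>(P :: 'b measure) Y. prob_space P \<and> all_moments_finite P Y \<and>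
        (\<forall>k. moment P Y k = moment M Z k) \<longrightarrow>
        distr P borel Y = distr M borel Z \<and> cdf (distr P borel Y) = \<Lambda>) \<and>
     (\<forall>(P :: 'b measure) Y. prob_space P \<and> all_moments_finite P Y \<and>
        (\<forall>j\<ge>1. cumulant P Y j = cumulant M Z j) \<longrightarrow>
        distr P borel Y = distr M borel Z \<and> cdf (distr P borel Y) = \<Lambda>) \<and>
     (\<exists>(P :: (nat \<Rightarrow> real) measure) U. prob_space P \<and> iid_uniform_3 P U \<and>
        (AE \<omega> in P. summable (\<lambda>i. U (Suc i) \<omega> / 2 ^ Suc i)) \<and>
        distr M borel Z = distr P borel (\<lambda>\<omega>. \<Sum>i. U (Suc i) \<omega> / 2 ^ Suc i)) \<and>
     (\<forall>(P :: 'c measure) U. prob_space P \<and> iid_uniform_3 P U \<longrightarrow>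
        (AE \<omega> in P. summable (\<lambda>i. U (Suc i) \<omega> / 2 ^ Suc i)) \<and>
        distr M borel Z = distr P borel (\<lambda>\<omega>. \<Sum>i. U (Suc i) \<omega> / 2 ^ Suc i)) \<and>
     (\<exists>C. AE \<omega> in M. \<bar>Z \<omega>\<bar> \<le> C) \<and>
     dist_support (distr M borel Z) = {-3..3}"
proof -
  interpret M: prob_space M by fact
  have Z: "Z \<in> borel_measurable M" by fact
  let ?P = "Pi\<^sub>M (UNIV :: nat set) (\<lambda>_. unif3)" and ?U = "\<lambda>i (\<omega> :: nat \<Rightarrow> real). \<omega> i"
  interpret I: iid_uniform ?P ?U by (rule iid_uniform_product)
  have law: "prob_space P \<and> iid_uniform_3 P U \<Longrightarrow>
      (AE \<omega> in P. summable (\<lambda>i. U (Suc i) \<omega> / 2 ^ Suc i)) \<and>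
        distr M borel Z = distr P borel (\<lambda>\<omega>. \<Sum>i. U (Suc i) \<omega> / 2 ^ Suc i)" for P :: "'c measure" and U
  proof -
    assume "prob_space P \<and> iid_uniform_3 P U"
    then interpret J: iid_uniform P U
      by (simp add: iid_uniform_def iid_uniform_axioms_def)
    show ?thesis
      using J.AE_summable J.distr_weak_limit_eq_distr_series[OF assms(1-3)] by (simp add: J.series_def[abs_def])
  qed
  have distr_Z: "distr M borel Z = distr ?P borel I.series"
    by (rule I.distr_weak_limit_eq_distr_series[OF assms(1-3)])
  have "AE x in distr M borel Z. \<bar>x\<bar> \<le> 3"
    unfolding distr_Z using I.AE_series_bounded by (subst AE_distr_iff) auto
  then have bdd: "AE \<omega> in M. \<bar>Z \<omega>\<bar> \<le> 3"
    using Z by (subst (asm) AE_distr_iff) auto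
  note fin = M.all_moments_finite_bounded(1)[OF Z bdd]
  have moments: "distr P borel Y = distr M borel Z"
    if "prob_space P" "all_moments_finite P Y" "\<And>k. moment P Y k = moment M Z k"
    for P :: "'b measure" and Y
    using that assms(1) fin M.all_moments_finite_bounded(2)[OF Z bdd]
    by (intro distr_eq_if_moments_eq)
  have cumulants: "distr P borel Y = distr M borel Z"
    if "prob_space P" "all_moments_finite P Y" "\<forall>j\<ge>1. cumulant P Y j = cumulant M Z j"
    for P :: "'b measure" and Y
    using that moments_eq_if_cumulants_eq[OF that(1) assms(1) that(3)] by (intro moments)
  show ?thesis
    unfolding assms(4)
  proof (intro conjI allI impI)
    show "all_moments_finite M Z" by (rule fin)
    show "distr P borel Y = distr M borel Z" "cdf (distr P borel Y) = cdf (distr M borel Z)"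
      if "prob_space P \<and> all_moments_finite P Y \<and> (\<forall>k. moment P Y k = moment M Z k)"
      for P :: "'b measure" and Y
      using that moments[of P Y] by auto
    show "distr P borel Y = distr M borel Z" "cdf (distr P borel Y) = cdf (distr M borel Z)"
      if "prob_space P \<and> all_moments_finite P Y \<and> (\<forall>j\<ge>1. cumulant P Y j = cumulant M Z j)"
      for P :: "'b measure" and Y
      using that cumulants[of P Y] by auto
    show "\<exists>(P :: (nat \<Rightarrow> real) measure) U. prob_space P \<and> iid_uniform_3 P U \<and>
        (AE \<omega> in P. summable (\<lambda>i. U (Suc i) \<omega> / 2 ^ Suc i)) \<and>
        distr M borel Z = distr P borel (\<lambda>\<omega>. \<Sum>i. U (Suc i) \<omega> / 2 ^ Suc i)"
      using I.prob_space_axioms I.iid I.AE_summable distr_Z[unfolded I.series_def[abs_def]]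
      by (intro exI[of _ ?P] exI[of _ ?U] conjI)
    show "AE \<omega> in P. summable (\<lambda>i. U (Suc i) \<omega> / 2 ^ Suc i)"
      "distr M borel Z = distr P borel (\<lambda>\<omega>. \<Sum>i. U (Suc i) \<omega> / 2 ^ Suc i)"
      if "prob_space P \<and> iid_uniform_3 P U" for P :: "'c measure" and U
      using law[OF that] by blast+
    show "\<exists>C. AE \<omega> in M. \<bar>Z \<omega>\<bar> \<le> C" using bdd by blast
    show "dist_support (distr M borel Z) = {-3..3}"
      unfolding distr_Z by (rule I.dist_support_series)
  qed
qed

end
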